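(* Let $B:\mathbf{Set}\to\mathbf{Set}$ be an ordered functor, $\Sigma$ a signature, and $\lambda:H_\Sigma(B\times\mathrm{Id})\Rightarrow BT_\Sigma$ a monotone abstract GSOS specification. Suppose that $(X,a,f)$ is an oplax $\lambda$-model and $(Y,b,g)$ is a lax $\lambda$-model. Then $\mathrm{ctx}_{a,b}:\mathrm{Rel}_{X,Y}\to\mathrm{Rel}_{X,Y}$ is $s$-respectful, where $s$ is the simulation functional for the $B$-coalgebras $(X,f)$ and $(Y,g)$.
   Context: $\mathrm{Rel}_{X,Y}$ is the set of relations $R\subseteq X\times Y$. An ordered functor is a functor $B:\mathbf{Set}\to\mathbf{Set}$ with a preorder $\sqsubseteq_{BX}$ on each $BX$ such that every $Bh$ is monotone; for maps $p,q:Z\to BX$, $p\sqsubseteq_{BX}q$ means pointwise. For a $B$-coalgebra $f:X\to BX$ etc. The relation lifting of $R\subseteq X\times Y$ (with projections $\pi_1,\pi_2$) is $\mathrm{Rel}(B)(R)=\{(B\pi_1(z),B\pi_2(z))\mid z\in B(R)\}$, and the lax lifting is $\mathrm{Rel}_\sqsubseteq(B)(R)={\sqsubseteq_{BX}}\,;\mathrm{Rel}(B)(R);{\sqsubseteq_{BY}}$ (relational composition). For coalgebras $(X,f)$, $(Y,g)$, the simulation functional is $s(R)=\{(x,y)\mid (f(x),g(y))\in\mathrm{Rel}_\sqsubseteq(B)(R)\}$. $H_\Sigma(X)=\coprod_{\sigma\in\Sigma}\{\sigma\}\times X^{\mathrm{ar}(\sigma)}$; $T_\Sigma(X)$ is the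 set of $\Sigma$-terms over variables in $X$ (the free monad of $H_\Sigma$). For an algebra $a:H_\Sigma X\to X$, $a^*:T_\Sigma X\to X$ is its inductive extension to terms (evaluation). An abstract GSOS specification is a natural transformation $\lambda:H_\Sigma(B\times\mathrm{Id})\Rightarrow BT_\Sigma$; it is monotone if for all $\sigma$ of arity $n$, all $u_i,v_i\in BX$ with $u_i\sqsubseteq_{BX}v_i$ and all $x_i\in X$, $\lambda_X(\sigma((u_1,x_1),\dots,(u_n,x_n)))\sqsubseteq_{BT_\Sigma X}\lambda_X(\sigma((v_1,x_1),\dots,(v_n,x_n)))$. Given an algebra $a:H_\Sigma X\to X$ and coalgebra $f:X\to BX$, $(X,a,f)$ is a lax $\lambda$-model if $f\circ a\sqsubseteq_{BX}Ba^*\circ\lambda_X\circ H_\Sigma\langle f,\mathrm{id}\rangle$, and an oplax $\lambda$-model if $f\circ a\sqsupseteq_{BX}Ba^*\circ\lambda_X\circ H_\Sigma\langle f,\mathrm{id}\rangle$. For algebras $a:H_\Sigma X\to X$, $b:H_\Sigma Y\to Y$, $\mathrm{ctx}_{a,b}(R)=\{(a^*(u),b^*(v))\mid (u,v)\in\mathrm{Rel}(T_\Sigma)(R)\}$, i.e. pairs obtained by evaluating two terms of identical shape whose corresponding variable positions are related by $R$. A monotone $F:\mathrm{Rel}_{X,Y}\to\mathrm{Rel}_{X,Y}$ is $s$-respectful if for every $R$, $F(s(R)\cap R)\subseteq s(F(R))\cap F(R)$.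
   Formalization: The inequalities defining lax and oplax λ-models are exchanged: lax means Ba*∘λ∘H⟨f,id⟩ ⊑ f∘a, and oplax means f∘a ⊑ Ba*∘λ∘H⟨f,id⟩; with the stated orientation the claim fails (powerset, one unary operator, λ = ∅). *)

theory Defs
  imports Main "HOL-Library.FuncSet"
begin

record 's signature =
  symbols :: "'s set"
  arity :: "'s \<Rightarrow> nat"

definition HSig :: "'s signature \<Rightarrow> 'x set \<Rightarrow> ('s \<times> 'x list) set" where
  "HSig Sg X = {(\<sigma>, xs). \<sigma> \<in> symbols Sg \<and> length xs = arity Sg \<sigma> \<and> set xs \<subseteq> X}"

definition Hmap :: "('x \<Rightarrow> 'y) \<Rightarrow> 's \<times> 'x list \<Rightarrow> 's \<times> 'y list" where
  "Hmap h = map_prod id (map h)"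

datatype ('s, 'x) trm = Var 'x | Op 's "('s, 'x) trm list"

inductive_set TSig :: "'s signature \<Rightarrow> 'x set \<Rightarrow> ('s, 'x) trm set"
  for Sg :: "'s signature" and X :: "'x set" where
  Var: "x \<in> X \<Longrightarrow> Var x \<in> TSig Sg X"
| Op: "\<sigma> \<in> symbols Sg \<Longrightarrow> length ts = arity Sg \<sigma> \<Longrightarrow> (\<And>t. t \<in> set ts \<Longrightarrow> t \<in> TSig Sg X)
    \<Longrightarrow> Op \<sigma> ts \<in> TSig Sg X"

abbreviation Tmap :: "('x \<Rightarrow> 'y) \<Rightarrow> ('s, 'x) trm \<Rightarrow> ('s, 'y) trm" where
  "Tmap \<equiv> map_trm id"

primrec eval :: "('s \<times> 'x list \<Rightarrow> 'x) \<Rightarrow> ('s, 'x) trm \<Rightarrow> 'x" where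
  "eval a (Var x) = x"
| "eval a (Op \<sigma> ts) = a (\<sigma>, map (eval a) ts)"

text \<open>
  HOL cannot quantify over functions on all types, so the sets to which a functor is applied are
  taken to be the subsets of one type. Over a type of atoms that is a parameter, the type
  \<open>univ\<close> is closed under pairs and under terms, so that relations between such sets
  (via \<open>Pr\<close>) and term algebras over them (via \<open>Tm\<close>) are again such sets.
\<close>

datatype ('s, 'a) univ =
    Atom 'a
  | Pr (un_Pr: "('s, 'a) univ \<times> ('s, 'a) univ")
  | Tm (un_Tm: "('s, ('s, 'a) univ) trm")

text \<open>
  A functor from the category of subsets of \<open>'u\<close> and maps between them to that of subsets of
  \<open>'v\<close>, with orders on its values. The type \<open>'v\<close> is not required to be \<open>'u\<close>,
  as this would exclude, e.g., the powerset functor. The action on a map depends on its domain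
  and codomain; a map is a HOL function considered only on its domain.
\<close>

record ('u, 'v) ordfun =
  obj :: "'u set \<Rightarrow> 'v set"
  arr :: "'u set \<Rightarrow> 'u set \<Rightarrow> ('u \<Rightarrow> 'u) \<Rightarrow> 'v \<Rightarrow> 'v"
  ord :: "'u set \<Rightarrow> 'v rel"

locale ordered_functor =
  fixes B :: "('u, 'v) ordfun"
  assumes arr_in: "h \<in> X \<rightarrow> Y \<Longrightarrow> arr B X Y h \<in> obj B X \<rightarrow> obj B Y"
    and arr_cong: "h \<in> X \<rightarrow> Y \<Longrightarrow> h' \<in> X \<rightarrow> Y \<Longrightarrow> (\<And>x. x \<in> X \<Longrightarrow> h x = h' x) \<Longrightarrow>
      z \<in> obj B X \<Longrightarrow> arr B X Y h z = arr B X Y h' z"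
    and arr_id: "z \<in> obj B X \<Longrightarrow> arr B X X id z = z"
    and arr_comp: "h \<in> X \<rightarrow> Y \<Longrightarrow> k \<in> Y \<rightarrow> Z \<Longrightarrow> z \<in> obj B X \<Longrightarrow>
      arr B X Z (k \<circ> h) z = arr B Y Z k (arr B X Y h z)"
    and preorder: "preorder_on (obj B X) (ord B X)"
    and arr_mono: "h \<in> X \<rightarrow> Y \<Longrightarrow> (u, v) \<in> ord B X \<Longrightarrow>
      (arr B X Y h u, arr B X Y h v) \<in> ord B Y"

definition Rel_lift :: "(('s, 'a) univ, 'v) ordfun \<Rightarrow> ('s, 'a) univ set \<Rightarrow> ('s, 'a) univ set \<Rightarrow>
    ('s, 'a) univ rel \<Rightarrow> 'v rel" where
  "Rel_lift B X Y R =
    {(arr B (Pr ` R) X (fst \<circ> un_Pr) z, arr B (Pr ` R) Y (snd \<circ> un_Pr) z) | z. z \<in> obj B (Pr ` R)}"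

definition lax_lift :: "(('s, 'a) univ, 'v) ordfun \<Rightarrow> ('s, 'a) univ set \<Rightarrow> ('s, 'a) univ set \<Rightarrow>
    ('s, 'a) univ rel \<Rightarrow> 'v rel" where
  "lax_lift B X Y R = ord B X O Rel_lift B X Y R O ord B Y"

definition simulation :: "(('s, 'a) univ, 'v) ordfun \<Rightarrow>
    ('s, 'a) univ set \<Rightarrow> (('s, 'a) univ \<Rightarrow> 'v) \<Rightarrow> ('s, 'a) univ set \<Rightarrow> (('s, 'a) univ \<Rightarrow> 'v) \<Rightarrow>
    ('s, 'a) univ rel \<Rightarrow> ('s, 'a) univ rel" where
  "simulation B X f Y g R = {(x, y) \<in> X \<times> Y. (f x, g y) \<in> lax_lift B X Y R}"

definition TSet :: "'s signature \<Rightarrow> ('s, 'a) univ set \<Rightarrow> ('s, 'a) univ set" where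
  "TSet Sg X = Tm ` TSig Sg X"

locale abstract_gsos =
  fixes Sg :: "'s signature" and B :: "(('s, 'a) univ, 'v) ordfun"
    and lam :: "('s, 'a) univ set \<Rightarrow> 's \<times> ('v \<times> ('s, 'a) univ) list \<Rightarrow> 'v"
  assumes lam_in: "lam X \<in> HSig Sg (obj B X \<times> X) \<rightarrow> obj B (TSet Sg X)"
    and lam_natural: "h \<in> X \<rightarrow> Y \<Longrightarrow> w \<in> HSig Sg (obj B X \<times> X) \<Longrightarrow>
      lam Y (Hmap (map_prod (arr B X Y h) h) w) =
      arr B (TSet Sg X) (TSet Sg Y) (Tm \<circ> Tmap h \<circ> un_Tm) (lam X w)"

locale monotone_abstract_gsos = abstract_gsos +
  assumes lam_mono: "\<sigma> \<in> symbols Sg \<Longrightarrow> length us = arity Sg \<sigma> \<Longrightarrow> length vs = arity Sg \<sigma> \<Longrightarrow>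
    length xs = arity Sg \<sigma> \<Longrightarrow> (\<And>i. i < arity Sg \<sigma> \<Longrightarrow> (us ! i, vs ! i) \<in> ord B X) \<Longrightarrow>
    set xs \<subseteq> X \<Longrightarrow>
    (lam X (\<sigma>, zip us xs), lam X (\<sigma>, zip vs xs)) \<in> ord B (TSet Sg X)"

definition model_rhs :: "'s signature \<Rightarrow> (('s, 'a) univ, 'v) ordfun \<Rightarrow>
    (('s, 'a) univ set \<Rightarrow> 's \<times> ('v \<times> ('s, 'a) univ) list \<Rightarrow> 'v) \<Rightarrow>
    ('s, 'a) univ set \<Rightarrow> ('s \<times> ('s, 'a) univ list \<Rightarrow> ('s, 'a) univ) \<Rightarrow>
    (('s, 'a) univ \<Rightarrow> 'v) \<Rightarrow> 's \<times> ('s, 'a) univ list \<Rightarrow> 'v" where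
  "model_rhs Sg B lam X a f w =
    arr B (TSet Sg X) X (eval a \<circ> un_Tm) (lam X (Hmap (\<lambda>x. (f x, x)) w))"

text \<open>
  The orientation matters. The lax lifting relates \<open>f x\<close> to \<open>g y\<close> when \<open>f x\<close> lies
  below and \<open>g y\<close> above a pair in the relation lifting. Context closure of a simulation then
  needs the rules to bound \<open>f\<close> from above on the simulated system (oplax) and \<open>g\<close> from
  below on the simulating one (lax): a lax model has at least the behaviour given by the rules, as
  saturated (weak) transition systems do. With the two inequalities exchanged closure fails,
  already for the powerset functor ordered by inclusion and a unary operator with no rules:
  an oplax \<open>X\<close> could then give its composite states arbitrary transitions, and a lax
  \<open>Y\<close> none.
\<close>

definition lax_model :: "'s signature \<Rightarrow> (('s, 'a) univ, 'v) ordfun \<Rightarrow>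
    (('s, 'a) univ set \<Rightarrow> 's \<times> ('v \<times> ('s, 'a) univ) list \<Rightarrow> 'v) \<Rightarrow>
    ('s, 'a) univ set \<Rightarrow> ('s \<times> ('s, 'a) univ list \<Rightarrow> ('s, 'a) univ) \<Rightarrow>
    (('s, 'a) univ \<Rightarrow> 'v) \<Rightarrow> bool" where
  "lax_model Sg B lam X a f \<longleftrightarrow> a \<in> HSig Sg X \<rightarrow> X \<and> f \<in> X \<rightarrow> obj B X \<and>
    (\<forall>w \<in> HSig Sg X. (model_rhs Sg B lam X a f w, f (a w)) \<in> ord B X)"

definition oplax_model :: "'s signature \<Rightarrow> (('s, 'a) univ, 'v) ordfun \<Rightarrow>
    (('s, 'a) univ set \<Rightarrow> 's \<times> ('v \<times> ('s, 'a) univ) list \<Rightarrow> 'v) \<Rightarrow>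
    ('s, 'a) univ set \<Rightarrow> ('s \<times> ('s, 'a) univ list \<Rightarrow> ('s, 'a) univ) \<Rightarrow>
    (('s, 'a) univ \<Rightarrow> 'v) \<Rightarrow> bool" where
  "oplax_model Sg B lam X a f \<longleftrightarrow> a \<in> HSig Sg X \<rightarrow> X \<and> f \<in> X \<rightarrow> obj B X \<and>
    (\<forall>w \<in> HSig Sg X. (f (a w), model_rhs Sg B lam X a f w) \<in> ord B X)"

definition Rel_T :: "'s signature \<Rightarrow> ('x \<times> 'y) set \<Rightarrow> (('s, 'x) trm \<times> ('s, 'y) trm) set" where
  "Rel_T Sg R = {(Tmap fst z, Tmap snd z) | z. z \<in> TSig Sg R}"

definition ctx :: "'s signature \<Rightarrow> ('s \<times> 'x list \<Rightarrow> 'x) \<Rightarrow> ('s \<times> 'y list \<Rightarrow> 'y) \<Rightarrow>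
    ('x \<times> 'y) set \<Rightarrow> ('x \<times> 'y) set" where
  "ctx Sg a b R = {(eval a u, eval b v) | u v. (u, v) \<in> Rel_T Sg R}"

definition respectful :: "'x set \<Rightarrow> 'y set \<Rightarrow> (('x \<times> 'y) set \<Rightarrow> ('x \<times> 'y) set) \<Rightarrow>
    (('x \<times> 'y) set \<Rightarrow> ('x \<times> 'y) set) \<Rightarrow> bool" where
  "respectful X Y s F \<longleftrightarrow> F \<in> Pow (X \<times> Y) \<rightarrow> Pow (X \<times> Y) \<and> mono_on (Pow (X \<times> Y)) F \<and>
    (\<forall>R \<in> Pow (X \<times> Y). F (s R \<inter> R) \<subseteq> s (F R) \<inter> F R)"

end

theory Submission
  imports Defs
begin

text \<open>
  The product algebra \<open>c\<close> on \<open>C = Pr ` ctx Sg a b R\<close> makes both projections algebra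
  homomorphisms. If related arguments have witnesses \<open>zs\<close> for the lax lifting, then applying
  \<open>lam C\<close> to these witnesses and evaluating the resulting term in \<open>c\<close> gives a witness
  for the composite states. By naturality its projections are instances of the right-hand sides of
  the models, so monotonicity together with the oplax and lax inequalities bounds the two
  behaviours.
\<close>

section \<open>Terms, renaming and evaluation\<close>

lemma map_trm_TSig:
  assumes "h \<in> X \<rightarrow> Y" "t \<in> TSig Sg X"
  shows "Tmap h t \<in> TSig Sg Y"
  using assms(2)
proof induction
  case (Var x)
  then show ?case using assms(1) by (auto intro: TSig.Var)
next
  case (Op \<sigma> ts)
  then show ?case by (auto intro!: TSig.Op)
qed

lemma TSig_mono: "X \<subseteq> Y \<Longrightarrow> TSig Sg X \<subseteq> TSig Sg Y"
  using map_trm_TSig[of id X Y _ Sg] by (auto simp: trm.map_id subset_iff)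

lemma eval_in:
  assumes "a \<in> HSig Sg X \<rightarrow> X" "t \<in> TSig Sg X"
  shows "eval a t \<in> X"
  using assms(2)
proof induction
  case (Op \<sigma> ts)
  then have "(\<sigma>, map (eval a) ts) \<in> HSig Sg X" by (auto simp: HSig_def)
  then show ?case using assms(1) by auto
qed simp

text \<open>Induction on \<open>t\<close>. The homomorphism law is available only on
  \<open>C\<close>, so \<open>eval_in\<close> is needed to keep the values of the subterms inside
  \<open>C\<close>.\<close>

lemma eval_hom:
  assumes "c \<in> HSig Sg C \<rightarrow> C"
    and hom: "\<And>w. w \<in> HSig Sg C \<Longrightarrow> h (c w) = a (Hmap h w)"
    and "t \<in> TSig Sg C"
  shows "h (eval c t) = eval a (Tmap h t)"
  using assms(3)
proof induction
  case (Op \<sigma> ts)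
  then have "(\<sigma>, map (eval c) ts) \<in> HSig Sg C"
    using eval_in[OF assms(1)] by (auto simp: HSig_def)
  then have "h (eval c (Op \<sigma> ts)) = a (\<sigma>, map (h \<circ> eval c) ts)"
    by (simp add: hom Hmap_def)
  also have "map (h \<circ> eval c) ts = map (eval a \<circ> Tmap h) ts"
    using Op by (simp add: id_def)
  finally show ?case by (simp add: id_def)
qed simp

lemma eval_un_Tm_in: "a \<in> HSig Sg X \<rightarrow> X \<Longrightarrow> eval a \<circ> un_Tm \<in> TSet Sg X \<rightarrow> X"
  by (auto simp: TSet_def eval_in)

lemma Tmap_un_Tm_in: "h \<in> X \<rightarrow> Y \<Longrightarrow> Tm \<circ> Tmap h \<circ> un_Tm \<in> TSet Sg X \<rightarrow> TSet Sg Y"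
  by (auto simp: TSet_def map_trm_TSig)

section \<open>Context closure\<close>

lemma ctx_mono: "R \<subseteq> S \<Longrightarrow> ctx Sg a b R \<subseteq> ctx Sg a b S"
  using TSig_mono[of R S Sg] unfolding ctx_def Rel_T_def by blast

lemma ctx_extensive: "R \<subseteq> ctx Sg a b R"
proof
  fix r assume "r \<in> R"
  then have "Var r \<in> TSig Sg R" by (rule TSig.Var)
  then have "(eval a (Tmap fst (Var r)), eval b (Tmap snd (Var r))) \<in> ctx Sg a b R"
    unfolding ctx_def Rel_T_def by blast
  then show "r \<in> ctx Sg a b R" by simp
qed

text \<open>Choose for each pair in \<open>rs\<close> one term over \<open>R\<close> that evaluates
  to it, and put \<sigma> on top of the chosen terms. This closure is what puts an algebra on the
  context closure.\<close>

lemma ctx_Op: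
  assumes "\<sigma> \<in> symbols Sg" "length rs = arity Sg \<sigma>" "set rs \<subseteq> ctx Sg a b R"
  shows "(a (\<sigma>, map fst rs), b (\<sigma>, map snd rs)) \<in> ctx Sg a b R"
proof -
  have "\<forall>r \<in> set rs. \<exists>t \<in> TSig Sg R. r = (eval a (Tmap fst t), eval b (Tmap snd t))"
    using assms(3) unfolding ctx_def Rel_T_def by blast
  then obtain t where t: "\<And>r. r \<in> set rs \<Longrightarrow> t r \<in> TSig Sg R"
      "\<And>r. r \<in> set rs \<Longrightarrow> r = (eval a (Tmap fst (t r)), eval b (Tmap snd (t r)))"
    by metis
  have "Op \<sigma> (map t rs) \<in> TSig Sg R" using assms t(1) by (intro TSig.Op) auto
  then have "(eval a (Tmap fst (Op \<sigma> (map t rs))), eval b (Tmap snd (Op \<sigma> (map t rs))))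
      \<in> ctx Sg a b R"
    unfolding ctx_def Rel_T_def by blast
  moreover have "map (eval a \<circ> (Tmap fst \<circ> t)) rs = map fst rs"
      "map (eval b \<circ> (Tmap snd \<circ> t)) rs = map snd rs"
    unfolding map_eq_conv by (metis comp_apply fst_conv t(2), metis comp_apply snd_conv t(2))
  ultimately show ?thesis by (simp add: comp_def id_def cong: map_cong)
qed

text \<open>Both components of a pair are values of one term over \<open>R\<close>, so induction on
  that term becomes induction on pairs. With \<open>ctx_extensive\<close> and \<open>ctx_Op\<close>,
  this makes the context closure the least relation containing \<open>R\<close> and closed under the
  operations; terms can be forgotten from here on.\<close>

lemma ctx_induct [consumes 1, case_names Var Op]:
  assumes "r \<in> ctx Sg a b R"
    and "\<And>r. r \<in> R \<Longrightarrow> P r"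
    and "\<And>\<sigma> rs. \<sigma> \<in> symbols Sg \<Longrightarrow> length rs = arity Sg \<sigma> \<Longrightarrow>
      set rs \<subseteq> ctx Sg a b R \<Longrightarrow> (\<And>r. r \<in> set rs \<Longrightarrow> P r) \<Longrightarrow>
      P (a (\<sigma>, map fst rs), b (\<sigma>, map snd rs))"
  shows "P r"
proof -
  have "P (eval a (Tmap fst t), eval b (Tmap snd t))" if "t \<in> TSig Sg R" for t
    using that
  proof induction
    case (Var r)
    then show ?case using assms(2) by simp
  next
    case (Op \<sigma> ts)
    let ?rs = "map (\<lambda>t. (eval a (Tmap fst t), eval b (Tmap snd t))) ts"
    have "set ?rs \<subseteq> ctx Sg a b R" using Op unfolding ctx_def Rel_T_def by auto
    then have "P (a (\<sigma>, map fst ?rs), b (\<sigma>, map snd ?rs))"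
      using Op by (intro assms(3)) (auto simp: id_def)
    then show ?case by (simp add: comp_def id_def)
  qed
  then show ?thesis using assms(1) unfolding ctx_def Rel_T_def by auto
qed

lemma ctx_subset:
  assumes "a \<in> HSig Sg X \<rightarrow> X" "b \<in> HSig Sg Y \<rightarrow> Y" "R \<subseteq> X \<times> Y"
  shows "ctx Sg a b R \<subseteq> X \<times> Y"
proof
  fix r assume "r \<in> ctx Sg a b R"
  then show "r \<in> X \<times> Y"
  proof (induction rule: ctx_induct)
    case (Op \<sigma> rs)
    then have "(\<sigma>, map fst rs) \<in> HSig Sg X" "(\<sigma>, map snd rs) \<in> HSig Sg Y"
      by (force simp: HSig_def)+
    then show ?case using assms(1,2) by auto
  qed (use assms(3) in blast)
qed

section \<open>The simulation functional and models of the specification\<close>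

locale univ_ordered_functor = ordered_functor B for B :: "(('s, 'a) univ, 'v) ordfun"
begin

lemma ord_trans: "(u, v) \<in> ord B X \<Longrightarrow> (v, w) \<in> ord B X \<Longrightarrow> (u, w) \<in> ord B X"
  using preorder[of X] by (auto simp: preorder_on_def elim: transE)

text \<open>The inclusion of \<open>R\<close> into \<open>S\<close> carries a witness for
  \<open>R\<close> to one for \<open>S\<close>. By functoriality the projections of the witness do
  not change.\<close>

lemma Rel_lift_mono:
  assumes "R \<subseteq> S" "S \<subseteq> X \<times> Y"
  shows "Rel_lift B X Y R \<subseteq> Rel_lift B X Y S"
proof
  fix p assume "p \<in> Rel_lift B X Y R"
  then obtain z where z: "z \<in> obj B (Pr ` R)"
      "p = (arr B (Pr ` R) X (fst \<circ> un_Pr) z, arr B (Pr ` R) Y (snd \<circ> un_Pr) z)"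
    unfolding Rel_lift_def by blast
  \<comment> \<open>Here \<open>id\<close> stands for the inclusion map. Its action need not be the
    identity, since \<open>arr\<close> depends on the domain and the codomain.\<close>
  have i: "id \<in> Pr ` R \<rightarrow> Pr ` S" using assms(1) by auto
  have "fst \<circ> un_Pr \<in> Pr ` S \<rightarrow> X" "snd \<circ> un_Pr \<in> Pr ` S \<rightarrow> Y" using assms(2) by auto
  then have "p = (arr B (Pr ` S) X (fst \<circ> un_Pr) (arr B (Pr ` R) (Pr ` S) id z),
      arr B (Pr ` S) Y (snd \<circ> un_Pr) (arr B (Pr ` R) (Pr ` S) id z))"
    using arr_comp[OF i _ z(1)] z(2) by (metis comp_id)
  moreover have "arr B (Pr ` R) (Pr ` S) id z \<in> obj B (Pr ` S)"
    using arr_in[OF i] z(1) by blast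
  ultimately show "p \<in> Rel_lift B X Y S" unfolding Rel_lift_def by blast
qed

lemma simulation_mono:
  assumes "R \<subseteq> S" "S \<subseteq> X \<times> Y"
  shows "simulation B X f Y g R \<subseteq> simulation B X f Y g S"
  using Rel_lift_mono[OF assms] unfolding simulation_def lax_lift_def by blast

lemma simulationE:
  assumes "r \<in> simulation B X f Y g R"
  obtains z where "z \<in> obj B (Pr ` R)"
    "(f (fst r), arr B (Pr ` R) X (fst \<circ> un_Pr) z) \<in> ord B X"
    "(arr B (Pr ` R) Y (snd \<circ> un_Pr) z, g (snd r)) \<in> ord B Y"
  using assms unfolding simulation_def lax_lift_def Rel_lift_def by auto

lemma simulationI:
  assumes "x \<in> X" "y \<in> Y" "z \<in> obj B (Pr ` R)"
    "(f x, arr B (Pr ` R) X (fst \<circ> un_Pr) z) \<in> ord B X"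
    "(arr B (Pr ` R) Y (snd \<circ> un_Pr) z, g y) \<in> ord B Y"
  shows "(x, y) \<in> simulation B X f Y g R"
  using assms unfolding simulation_def lax_lift_def Rel_lift_def by auto

text \<open>Functoriality fuses \<open>h\<close> with \<open>eval c\<close>, the homomorphism law
  replaces this by renaming along \<open>h\<close> followed by \<open>eval a\<close>, and naturality
  of \<open>lam\<close> absorbs the renaming.\<close>

lemma arr_eval_lam:
  assumes "abstract_gsos Sg B lam"
    and h: "h \<in> C \<rightarrow> X" and c: "c \<in> HSig Sg C \<rightarrow> C" and a: "a \<in> HSig Sg X \<rightarrow> X"
    and hom: "\<And>w. w \<in> HSig Sg C \<Longrightarrow> h (c w) = a (Hmap h w)"
    and w: "w \<in> HSig Sg (obj B C \<times> C)"
  shows "arr B C X h (arr B (TSet Sg C) C (eval c \<circ> un_Tm) (lam C w)) =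
    arr B (TSet Sg X) X (eval a \<circ> un_Tm) (lam X (Hmap (map_prod (arr B C X h) h) w))"
proof -
  interpret abstract_gsos Sg B lam by fact
  let ?T = "Tm \<circ> Tmap h \<circ> un_Tm"
  have l: "lam C w \<in> obj B (TSet Sg C)" using lam_in w by blast
  note ec = eval_un_Tm_in[OF c] and ea = eval_un_Tm_in[OF a]
  note T = Tmap_un_Tm_in[OF h, of Sg]
  have "arr B C X h (arr B (TSet Sg C) C (eval c \<circ> un_Tm) (lam C w)) =
      arr B (TSet Sg C) X (h \<circ> (eval c \<circ> un_Tm)) (lam C w)"
    using arr_comp[OF ec h l] by simp
  also have "\<dots> = arr B (TSet Sg C) X ((eval a \<circ> un_Tm) \<circ> ?T) (lam C w)"
  proof (rule arr_cong[OF _ _ _ l])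
    show "h \<circ> (eval c \<circ> un_Tm) \<in> TSet Sg C \<rightarrow> X" using ec h by (auto simp: Pi_iff)
    show "(eval a \<circ> un_Tm) \<circ> ?T \<in> TSet Sg C \<rightarrow> X" using ea T unfolding Pi_iff comp_apply by blast
    show "(h \<circ> (eval c \<circ> un_Tm)) x = ((eval a \<circ> un_Tm) \<circ> ?T) x" if "x \<in> TSet Sg C" for x
      using that eval_hom[of c Sg C h a, OF c hom] by (auto simp: TSet_def)
  qed
  also have "\<dots> = arr B (TSet Sg X) X (eval a \<circ> un_Tm) (lam X (Hmap (map_prod (arr B C X h) h) w))"
    by (simp add: arr_comp[OF T ea l] lam_natural[OF h w])
  finally show ?thesis .
qed

lemma simulation_Op:
  assumes gsos: "monotone_abstract_gsos Sg B lam"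
    and oplax: "oplax_model Sg B lam X a f" and lax: "lax_model Sg B lam Y b g"
    and R: "R \<subseteq> X \<times> Y"
    and closed: "\<And>\<sigma> rs. \<sigma> \<in> symbols Sg \<Longrightarrow> length rs = arity Sg \<sigma> \<Longrightarrow> set rs \<subseteq> R \<Longrightarrow>
      (a (\<sigma>, map fst rs), b (\<sigma>, map snd rs)) \<in> R"
    and \<sigma>: "\<sigma> \<in> symbols Sg" and len: "length rs = arity Sg \<sigma>"
    and rs: "set rs \<subseteq> R" "set rs \<subseteq> simulation B X f Y g R"
  shows "(a (\<sigma>, map fst rs), b (\<sigma>, map snd rs)) \<in> simulation B X f Y g R"
proof -
  interpret monotone_abstract_gsos Sg B lam by (fact gsos)
  let ?C = "Pr ` R" and ?p = "fst \<circ> un_Pr" and ?q = "snd \<circ> un_Pr"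
  have a: "a \<in> HSig Sg X \<rightarrow> X" and b: "b \<in> HSig Sg Y \<rightarrow> Y"
    using oplax lax by (auto simp: oplax_model_def lax_model_def)
  have p: "?p \<in> ?C \<rightarrow> X" and q: "?q \<in> ?C \<rightarrow> Y" using R by auto
  \<comment> \<open>With this choice the homomorphism law for both projections holds by
    definition.\<close>
  define c where "c = (\<lambda>w. Pr (a (Hmap ?p w), b (Hmap ?q w)))"
  have c: "c \<in> HSig Sg ?C \<rightarrow> ?C"
  proof
    fix w assume "w \<in> HSig Sg ?C"
    then obtain \<tau> xs where w: "w = (\<tau>, xs)" "\<tau> \<in> symbols Sg" "length xs = arity Sg \<tau>"
        "set xs \<subseteq> ?C"
      by (auto simp: HSig_def)
    then have "(a (\<tau>, map fst (map un_Pr xs)), b (\<tau>, map snd (map un_Pr xs))) \<in> R"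
      by (intro closed) auto
    then show "c w \<in> ?C" by (simp add: c_def Hmap_def w(1))
  qed
  obtain z where z: "\<And>r. r \<in> set rs \<Longrightarrow> z r \<in> obj B ?C"
    and zp: "\<And>r. r \<in> set rs \<Longrightarrow> (f (fst r), arr B ?C X ?p (z r)) \<in> ord B X"
    and zq: "\<And>r. r \<in> set rs \<Longrightarrow> (arr B ?C Y ?q (z r), g (snd r)) \<in> ord B Y"
  proof -
    have "\<forall>r \<in> set rs. \<exists>z. z \<in> obj B ?C \<and> (f (fst r), arr B ?C X ?p z) \<in> ord B X \<and>
        (arr B ?C Y ?q z, g (snd r)) \<in> ord B Y"
      using rs(2) by (blast elim: simulationE)
    then show ?thesis using that by metis
  qed
  \<comment> \<open>An argument of \<open>lam\<close> consists of a behaviour and a state: the state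
    is the pair \<open>r\<close> itself, the behaviour its witness.\<close>
  define w where "w = (\<sigma>, map (\<lambda>r. (z r, Pr r)) rs)"
  have w: "w \<in> HSig Sg (obj B ?C \<times> ?C)"
    using \<sigma> len rs(1) z by (auto simp: w_def HSig_def)
  define u where "u = arr B (TSet Sg ?C) ?C (eval c \<circ> un_Tm) (lam ?C w)"
  have u: "u \<in> obj B ?C"
    using lam_in w arr_in[OF eval_un_Tm_in[OF c]] unfolding u_def by blast
  \<comment> \<open>The states project to \<open>map fst rs\<close>, the list that also occurs in
    the right-hand side of the model. Only the behaviours differ, as \<open>lam_mono\<close>
    requires.\<close>
  have up: "arr B ?C X ?p u = arr B (TSet Sg X) X (eval a \<circ> un_Tm)
      (lam X (\<sigma>, zip (map (\<lambda>r. arr B ?C X ?p (z r)) rs) (map fst rs)))"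
    unfolding u_def
    by (subst arr_eval_lam[OF abstract_gsos_axioms p c a _ w])
      (simp_all add: c_def w_def Hmap_def zip_map_map zip_same_conv_map comp_def)
  have uq: "arr B ?C Y ?q u = arr B (TSet Sg Y) Y (eval b \<circ> un_Tm)
      (lam Y (\<sigma>, zip (map (\<lambda>r. arr B ?C Y ?q (z r)) rs) (map snd rs)))"
    unfolding u_def
    by (subst arr_eval_lam[OF abstract_gsos_axioms q c b _ w])
      (simp_all add: c_def w_def Hmap_def zip_map_map zip_same_conv_map comp_def)
  have x: "(\<sigma>, map fst rs) \<in> HSig Sg X" and y: "(\<sigma>, map snd rs) \<in> HSig Sg Y"
    using \<sigma> len rs(1) R by (force simp: HSig_def)+
  have "(f (a (\<sigma>, map fst rs)), model_rhs Sg B lam X a f (\<sigma>, map fst rs)) \<in> ord B X"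
    using oplax x unfolding oplax_model_def by blast
  then have "(f (a (\<sigma>, map fst rs)), arr B (TSet Sg X) X (eval a \<circ> un_Tm)
      (lam X (\<sigma>, zip (map (\<lambda>r. f (fst r)) rs) (map fst rs)))) \<in> ord B X"
    by (simp add: model_rhs_def Hmap_def zip_map_map zip_same_conv_map comp_def)
  \<comment> \<open>By \<open>zp\<close> each \<open>f (fst r)\<close> lies below the projected
    witness; \<open>lam_mono\<close> and then \<open>arr_mono\<close> carry this through the rule
    and the evaluation.\<close>
  moreover have "(arr B (TSet Sg X) X (eval a \<circ> un_Tm)
      (lam X (\<sigma>, zip (map (\<lambda>r. f (fst r)) rs) (map fst rs))), arr B ?C X ?p u) \<in> ord B X"
    unfolding up using \<sigma> len x zp
    by (intro arr_mono[OF eval_un_Tm_in[OF a]] lam_mono) (simp_all add: HSig_def)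
  ultimately have le: "(f (a (\<sigma>, map fst rs)), arr B ?C X ?p u) \<in> ord B X"
    by (rule ord_trans)
  \<comment> \<open>On the second side the order of the two inequalities is reversed: first the
    witnesses, by \<open>zq\<close>, then the lax model.\<close>
  have "(arr B ?C Y ?q u, arr B (TSet Sg Y) Y (eval b \<circ> un_Tm)
      (lam Y (\<sigma>, zip (map (\<lambda>r. g (snd r)) rs) (map snd rs)))) \<in> ord B Y"
    unfolding uq using \<sigma> len y zq
    by (intro arr_mono[OF eval_un_Tm_in[OF b]] lam_mono) (simp_all add: HSig_def)
  moreover have "(model_rhs Sg B lam Y b g (\<sigma>, map snd rs), g (b (\<sigma>, map snd rs))) \<in> ord B Y"
    using lax y unfolding lax_model_def by blast
  then have "(arr B (TSet Sg Y) Y (eval b \<circ> un_Tm)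
      (lam Y (\<sigma>, zip (map (\<lambda>r. g (snd r)) rs) (map snd rs))), g (b (\<sigma>, map snd rs))) \<in> ord B Y"
    by (simp add: model_rhs_def Hmap_def zip_map_map zip_same_conv_map comp_def)
  ultimately have ge: "(arr B ?C Y ?q u, g (b (\<sigma>, map snd rs))) \<in> ord B Y"
    by (rule ord_trans)
  show ?thesis using a b x y u le ge by (intro simulationI) auto
qed

end

theorem theorem19:
  fixes Sg :: "'s signature" and B :: "(('s, 'a) univ, 'v) ordfun"
    and lam :: "('s, 'a) univ set \<Rightarrow> 's \<times> ('v \<times> ('s, 'a) univ) list \<Rightarrow> 'v"
    and X Y :: "('s, 'a) univ set"
    and a b :: "'s \<times> ('s, 'a) univ list \<Rightarrow> ('s, 'a) univ"
    and f g :: "('s, 'a) univ \<Rightarrow> 'v"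
  assumes "ordered_functor B"
    and "monotone_abstract_gsos Sg B lam"
    and "oplax_model Sg B lam X a f"
    and "lax_model Sg B lam Y b g"
  shows "respectful X Y (simulation B X f Y g) (ctx Sg a b)"
proof -
  interpret univ_ordered_functor B using assms(1) by (rule univ_ordered_functor.intro)
  let ?s = "simulation B X f Y g" and ?ctx = "ctx Sg a b"
  have a: "a \<in> HSig Sg X \<rightarrow> X" and b: "b \<in> HSig Sg Y \<rightarrow> Y"
    using assms(3,4) by (auto simp: oplax_model_def lax_model_def)
  note sub = ctx_subset[OF a b]
  have "?ctx (?s R \<inter> R) \<subseteq> ?s (?ctx R)" if R: "R \<subseteq> X \<times> Y" for R
  proof
    fix r assume "r \<in> ?ctx (?s R \<inter> R)"
    then show "r \<in> ?s (?ctx R)"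
    proof (induction rule: ctx_induct)
      case (Var r)
      then show ?case using simulation_mono[OF ctx_extensive sub[OF R]] by blast
    next
      case (Op \<sigma> rs)
      \<comment> \<open>The induction hypothesis gives only membership in
        \<open>?s (?ctx R)\<close>; \<open>simulation_Op\<close> also needs the arguments in
        \<open>?ctx R\<close>.\<close>
      have "set rs \<subseteq> ?ctx R" using Op.hyps ctx_mono[of "?s R \<inter> R" R Sg a b] by blast
      then show ?case
        using Op by (intro simulation_Op[OF assms(2-4) sub[OF R] ctx_Op]) auto
    qed
  qed
  \<comment> \<open>The other half of respectfulness is monotonicity alone.\<close>
  moreover have "?ctx (?s R \<inter> R) \<subseteq> ?ctx R" for R
    by (rule ctx_mono) blast
  ultimately show ?thesis
    unfolding respectful_def using sub by (auto intro!: mono_onI dest: subsetD[OF ctx_mono])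
qed

end
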